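(* Let $B$ be planar standard Brownian motion started at the origin. There exists a constant $K>0$ such that for all positive integers $n$ and all real $r\ge 1$, $$\mathbb{P}\Big\{\sup_{0\leq t \leq n}|B(t)| \leq r^{-1}n^{1/2}\Big\} \leq \exp\{-K r^2\}.$$
   Context: $|\cdot|$ is the Euclidean norm on $\mathbb{R}^2$. *)

theory Defs
  imports "HOL-Probability.Probability"
begin

text \<open>
  Processes are indexed by \<^typ>\<open>real\<close>; only times \<open>t \<ge> 0\<close> are constrained. The starting value and
  the continuity of paths are required almost surely only, which covers the convention that they
  hold for every outcome.
\<close>

locale linear_brownian_motion = prob_space M
  for M :: "'w measure" +
  fixes W :: "real \<Rightarrow> 'w \<Rightarrow> real"
  assumes random_variable_W: "t \<ge> 0 \<Longrightarrow> random_variable borel (W t)"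
    and start: "AE \<omega> in M. W 0 \<omega> = 0"
    and indep_increments: "\<And>(k::nat) (t::nat \<Rightarrow> real). 0 \<le> t 0 \<Longrightarrow> mono t \<Longrightarrow>
          indep_vars (\<lambda>_. borel) (\<lambda>i \<omega>. W (t (Suc i)) \<omega> - W (t i) \<omega>) {..<k}"
    and normal_increments: "0 \<le> s \<Longrightarrow> s < t \<Longrightarrow>
          distributed M lborel (\<lambda>\<omega>. W t \<omega> - W s \<omega>) (normal_density 0 (sqrt (t - s)))"
    and continuous_paths: "AE \<omega> in M. continuous_on {0..} (\<lambda>t. W t \<omega>)"

text \<open>
  The coordinates are independent as processes: the generated \<open>\<sigma>\<close>-algebras of the whole coordinate
  paths are independent, expressed through the product \<open>\<sigma>\<close>-algebra on functions on \<open>[0, \<infinity>)\<close>.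
\<close>

locale planar_brownian_motion = prob_space M
  for M :: "'w measure" +
  fixes B :: "real \<Rightarrow> 'w \<Rightarrow> real^2"
  assumes coordinates: "linear_brownian_motion M (\<lambda>t \<omega>. B t \<omega> $ i)"
    and indep_coordinates: "indep_vars (\<lambda>_. Pi\<^sub>M {0..} (\<lambda>_. borel))
          (\<lambda>(i::2) \<omega>. \<lambda>t\<in>{0::real..}. B t \<omega> $ i) UNIV"
begin

lemma continuous_paths: "AE \<omega> in M. continuous_on {0..} (\<lambda>t. B t \<omega>)"
proof -
  have "AE \<omega> in M. \<forall>i\<in>UNIV. continuous_on {0..} (\<lambda>t. B t \<omega> $ i)"
    using linear_brownian_motion.continuous_paths[OF coordinates]
    by (intro AE_finite_allI) auto
  then show ?thesis
  proof eventually_elim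
    case (elim \<omega>)
    then have "continuous_on {0..} (\<lambda>t. \<chi> i. B t \<omega> $ i)"
      by (intro continuous_on_vec_lambda) auto
    then show ?case by simp
  qed
qed

text \<open>
  As paths are only almost surely continuous, the event below need not lie in \<open>M\<close> itself when
  \<open>M\<close> is not complete. It lies in the completion, so its measure there is meaningful.
\<close>

lemma sup_norm_le_in_completion:
  fixes T c :: real
  assumes "T \<ge> 0"
  shows "{\<omega> \<in> space M. (SUP t\<in>{0..T}. norm (B t \<omega>)) \<le> c} \<in> sets (completion M)"
proof -
  obtain D where D: "countable D" "D \<subseteq> {0..T}" "{0..T} \<subseteq> closure D"
    using separable by blast
  have rv: "B t \<in> borel_measurable M" if "t \<ge> 0" for t
    using linear_brownian_motion.random_variable_W[OF coordinates that]
    by (subst borel_measurable_euclidean_space)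
       (auto simp: Basis_vec_def inner_axis)
  let ?G = "{\<omega> \<in> space M. \<forall>t\<in>D. norm (B t \<omega>) \<le> c}"
  have G: "?G \<in> sets M"
  proof (rule sets.sets_Collect_countable_All'[OF _ D(1)])
    fix t assume "t \<in> D"
    then have "B t \<in> borel_measurable M" using D(2) rv by force
    then show "{\<omega> \<in> space M. norm (B t \<omega>) \<le> c} \<in> sets M" by measurable
  qed
  have eq: "(SUP t\<in>{0..T}. norm (B t \<omega>)) \<le> c \<longleftrightarrow> (\<forall>t\<in>D. norm (B t \<omega>) \<le> c)"
    if cont: "continuous_on {0..} (\<lambda>t. B t \<omega>)" for \<omega>
  proof
    have cn: "continuous_on {0..T} (\<lambda>t. norm (B t \<omega>))"
      by (intro continuous_on_norm continuous_on_subset[OF cont]) auto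
    then have bdd: "bdd_above ((\<lambda>t. norm (B t \<omega>)) ` {0..T})"
      by (intro bounded_imp_bdd_above compact_imp_bounded compact_continuous_image) auto
    show "\<forall>t\<in>D. norm (B t \<omega>) \<le> c" if "(SUP t\<in>{0..T}. norm (B t \<omega>)) \<le> c"
      using that D(2) cSUP_upper[OF _ bdd] by (meson order_trans subsetD)
    assume *: "\<forall>t\<in>D. norm (B t \<omega>) \<le> c"
    have "closed {t \<in> {0..T}. norm (B t \<omega>) \<le> c}"
      by (intro continuous_on_closed_Collect_le cn continuous_on_const) auto
    with * D(2) have "closure D \<subseteq> {t \<in> {0..T}. norm (B t \<omega>) \<le> c}"
      by (intro closure_minimal) auto
    with D(3) assms show "(SUP t\<in>{0..T}. norm (B t \<omega>)) \<le> c"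
      by (intro cSUP_least) auto
  qed
  have "AE \<omega> in completion M. \<omega> \<in> ?G \<longleftrightarrow>
      \<omega> \<in> {\<omega> \<in> space M. (SUP t\<in>{0..T}. norm (B t \<omega>)) \<le> c}"
    using AE_completion[OF continuous_paths] by eventually_elim (auto simp: eq)
  then show ?thesis
    by (rule completion.in_sets_AE) (use G in auto)
qed

end

end

theory Submission
  imports Defs
begin

text \<open>
  If the path stays in the ball of radius \<open>c\<close> up to time \<open>n\<close>, then so does its first coordinate, all
  of whose increments are at most \<open>2 c\<close>. Splitting \<open>[0, n]\<close> into about \<open>r\<^sup>2 / 16\<close> intervals, each of
  length comparable with \<open>c\<^sup>2 = n / r\<^sup>2\<close>, gives that many independent increments, each of which is
  that small with probability at most \<open>1/2\<close> because the Gaussian density is bounded by its value at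
  \<open>0\<close>. For bounded \<open>r\<close> it suffices to look at the position at time \<open>n\<close>.
\<close>

lemma normal_density_le:
  assumes "\<sigma> > 0"
  shows "normal_density \<mu> \<sigma> x \<le> 1 / (\<sigma> * sqrt (2 * pi))"
proof -
  have "1 / sqrt (2 * pi * \<sigma>\<^sup>2) = 1 / (\<sigma> * sqrt (2 * pi))"
    using assms by (simp add: real_sqrt_mult)
  moreover have "exp (- (x - \<mu>)\<^sup>2 / (2 * \<sigma>\<^sup>2)) \<le> 1"
    by simp
  moreover have "0 \<le> 1 / (\<sigma> * sqrt (2 * pi))"
    using assms by simp
  ultimately show ?thesis
    unfolding normal_density_def by (simp only: mult_left_le)
qed

text \<open>The bound is the length \<open>2 * a\<close> of the interval times the peak of the
  density.\<close>

lemma (in prob_space) prob_normal_abs_le: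
  assumes D: "distributed M lborel X (normal_density \<mu> \<sigma>)" and "\<sigma> > 0" "a \<ge> 0"
  shows "prob {\<omega> \<in> space M. \<bar>X \<omega>\<bar> \<le> a} \<le> 2 * a / (\<sigma> * sqrt (2 * pi))"
proof -
  let ?C = "1 / (\<sigma> * sqrt (2 * pi))"
  have C: "?C \<ge> 0" using \<open>\<sigma> > 0\<close> by simp
  have "{\<omega> \<in> space M. \<bar>X \<omega>\<bar> \<le> a} = X -` {-a..a} \<inter> space M"
    by auto
  then have "emeasure M {\<omega> \<in> space M. \<bar>X \<omega>\<bar> \<le> a}
      = (\<integral>\<^sup>+x. ennreal (normal_density \<mu> \<sigma> x) * indicator {-a..a} x \<partial>lborel)"
    using distributed_emeasure[OF D, of "{-a..a}"] by simp
  also have "\<dots> \<le> (\<integral>\<^sup>+x. ennreal ?C * indicator {-a..a} x \<partial>lborel)"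
    using normal_density_le[OF \<open>\<sigma> > 0\<close>]
    by (intro nn_integral_mono mult_right_mono ennreal_leI) auto
  also have "\<dots> = ennreal (?C * (2 * a))"
    using C \<open>a \<ge> 0\<close> by (subst nn_integral_cmult_indicator) (auto simp: ennreal_mult[symmetric])
  finally show ?thesis
    using C \<open>a \<ge> 0\<close> by (simp add: emeasure_eq_measure mult.commute)
qed

text \<open>Increments over successive intervals of length \<open>\<delta>\<close> are independent
  with variance \<open>\<delta>\<close>, so the bounds for single increments multiply. Measurability
  is recorded as well, since \<open>prob_sup_norm_le\<close> compares with an event of
  \<open>M\<close>.\<close>

lemma (in linear_brownian_motion) prob_increments_le:
  assumes "\<delta> > 0" "a \<ge> 0"
  shows "prob {\<omega> \<in> space M. \<forall>i<k. \<bar>W (real (Suc i) * \<delta>) \<omega> - W (real i * \<delta>) \<omega>\<bar> \<le> a}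
      \<le> (2 * a / sqrt (2 * pi * \<delta>)) ^ k"
    and "{\<omega> \<in> space M. \<forall>i<k. \<bar>W (real (Suc i) * \<delta>) \<omega> - W (real i * \<delta>) \<omega>\<bar> \<le> a} \<in> events"
proof -
  let ?X = "\<lambda>i \<omega>. W (real (Suc i) * \<delta>) \<omega> - W (real i * \<delta>) \<omega>"
  have meas [measurable]: "?X i \<in> borel_measurable M" for i
    using \<open>\<delta> > 0\<close> by (intro borel_measurable_diff random_variable_W) auto
  show "{\<omega> \<in> space M. \<forall>i<k. \<bar>?X i \<omega>\<bar> \<le> a} \<in> events"
    by measurable
  have D: "distributed M lborel (?X i) (normal_density 0 (sqrt \<delta>))" for i
    using normal_increments[of "real i * \<delta>" "real (Suc i) * \<delta>"] \<open>\<delta> > 0\<close>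
    by (simp add: algebra_simps)
  have one: "prob (?X i -` {-a..a} \<inter> space M) \<le> 2 * a / sqrt (2 * pi * \<delta>)" for i
  proof -
    have "?X i -` {-a..a} \<inter> space M = {\<omega> \<in> space M. \<bar>?X i \<omega>\<bar> \<le> a}"
      by auto
    then show ?thesis
      using prob_normal_abs_le[OF D[of i] _ \<open>a \<ge> 0\<close>] \<open>\<delta> > 0\<close>
      by (simp add: real_sqrt_mult mult.commute mult.left_commute)
  qed
  have ind: "indep_vars (\<lambda>_. borel) ?X {..<k}"
    using indep_increments[of "\<lambda>i. real i * \<delta>" k] \<open>\<delta> > 0\<close> by (auto simp: mono_def)
  show "prob {\<omega> \<in> space M. \<forall>i<k. \<bar>?X i \<omega>\<bar> \<le> a} \<le> (2 * a / sqrt (2 * pi * \<delta>)) ^ k"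
  \<comment> \<open>An intersection over the empty index set would be \<open>UNIV\<close> instead of
    \<open>space M\<close>.\<close>
  proof (cases "k = 0")
    case True
    then show ?thesis by simp
  next
    case False
    have "{\<omega> \<in> space M. \<forall>i<k. \<bar>?X i \<omega>\<bar> \<le> a} = (\<Inter>i\<in>{..<k}. ?X i -` {-a..a} \<inter> space M)"
      using False by (auto simp: abs_le_iff minus_le_iff)
    also have "prob \<dots> = (\<Prod>i<k. prob (?X i -` {-a..a} \<inter> space M))"
      using False by (intro indep_varsD[OF ind]) auto
    also have "\<dots> \<le> (\<Prod>i<k. 2 * a / sqrt (2 * pi * \<delta>))"
      by (intro prod_mono) (use one in auto)
    finally show ?thesis by simp
  qed
qed

text \<open>This passes from the completion, where the supremum event lives, to an event
  \<open>E\<close> of \<open>M\<close>, on which both measures agree. Inclusion in \<open>E\<close>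
  is needed only almost surely, so continuity and the start at 0 may be assumed of the path.\<close>

lemma (in planar_brownian_motion) prob_sup_norm_le:
  assumes "T \<ge> 0" "E \<in> events"
    and E: "\<And>\<omega>. \<omega> \<in> space M \<Longrightarrow> B 0 \<omega> $ i = 0 \<Longrightarrow> (\<And>t. 0 \<le> t \<Longrightarrow> t \<le> T \<Longrightarrow> \<bar>B t \<omega> $ i\<bar> \<le> c) \<Longrightarrow> \<omega> \<in> E"
  shows "measure (completion M) {\<omega> \<in> space M. (SUP t\<in>{0..T}. norm (B t \<omega>)) \<le> c} \<le> prob E"
proof -
  interpret C: prob_space "completion M"
    by (intro prob_spaceI) (simp add: emeasure_space_1)
  have "AE \<omega> in M. \<omega> \<in> {\<omega> \<in> space M. (SUP t\<in>{0..T}. norm (B t \<omega>)) \<le> c} \<longrightarrow> \<omega> \<in> E"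
    using continuous_paths linear_brownian_motion.start[OF coordinates[of i]]
  proof eventually_elim
    case (elim \<omega>)
    show ?case
    proof
      assume \<omega>: "\<omega> \<in> {\<omega> \<in> space M. (SUP t\<in>{0..T}. norm (B t \<omega>)) \<le> c}"
      have "continuous_on {0..T} (\<lambda>t. norm (B t \<omega>))"
        by (intro continuous_on_norm continuous_on_subset[OF elim(1)]) auto
      \<comment> \<open>A real \<open>SUP\<close> dominates its family only if the family is bounded
        above; continuity on a compact interval ensures this.\<close>
      then have bdd: "bdd_above ((\<lambda>t. norm (B t \<omega>)) ` {0..T})"
        by (intro bounded_imp_bdd_above compact_imp_bounded compact_continuous_image) auto
      have "\<bar>B t \<omega> $ i\<bar> \<le> c" if "0 \<le> t" "t \<le> T" for t
      proof -
        have "\<bar>B t \<omega> $ i\<bar> \<le> norm (B t \<omega>)"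
          by (rule component_le_norm_cart)
        also have "\<dots> \<le> (SUP t\<in>{0..T}. norm (B t \<omega>))"
          using that by (intro cSUP_upper[OF _ bdd]) auto
        finally show ?thesis using \<omega> by simp
      qed
      then show "\<omega> \<in> E" using E \<omega> elim(2) by blast
    qed
  qed
  then have "measure (completion M) {\<omega> \<in> space M. (SUP t\<in>{0..T}. norm (B t \<omega>)) \<le> c}
      \<le> measure (completion M) E"
    using \<open>E \<in> events\<close> by (intro C.finite_measure_mono_AE AE_completion) auto
  then show ?thesis
    using \<open>E \<in> events\<close> by simp
qed

theorem lemma3p4:
  fixes M :: "'w measure" and B :: "real \<Rightarrow> 'w \<Rightarrow> real^2"
  assumes "planar_brownian_motion M B"
  shows "\<exists>K>0. \<forall>(n::nat) (r::real). n > 0 \<longrightarrow> r \<ge> 1 \<longrightarrow>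
    measure (completion M) {\<omega> \<in> space M. (SUP t\<in>{0..real n}. norm (B t \<omega>)) \<le> inverse r * sqrt (real n)}
      \<le> exp (- K * r\<^sup>2)"
\<comment> \<open>Small \<open>r\<close> dictates the constant: for \<open>r^2 \<le> 32\<close> the
  probability is at most 4/5 = 1 - 32/160. Large \<open>r\<close> would even allow 1/64.\<close>
proof (intro exI[of _ "1/160"] conjI allI impI)
  fix n :: nat and r :: real
  assume n: "n > 0" and r: "r \<ge> 1"
  interpret planar_brownian_motion M B by fact
  interpret W: linear_brownian_motion M "\<lambda>t \<omega>. B t \<omega> $ 1"
    by (rule coordinates)
  define c where "c = inverse r * sqrt (real n)"
  have c: "c \<ge> 0" using r by (simp add: c_def)
  let ?S = "{\<omega> \<in> space M. (SUP t\<in>{0..real n}. norm (B t \<omega>)) \<le> c}"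
  have "measure (completion M) ?S \<le> exp (- (1/160) * r\<^sup>2)"
  proof (cases "r\<^sup>2 \<le> 32")
    case True
    \<comment> \<open>The single increment starts at 0, so it is bounded by \<open>c\<close> and not
      just \<open>2 * c\<close>; with \<open>2 * c\<close> the estimate would exceed 1 at
      \<open>r = 1\<close>.\<close>
    let ?E = "{\<omega> \<in> space M. \<forall>i<1. \<bar>B (real (Suc i) * real n) \<omega> $ 1 - B (real i * real n) \<omega> $ 1\<bar> \<le> c}"
    have "measure (completion M) ?S \<le> prob ?E"
      by (rule prob_sup_norm_le[where i = 1]) (use n c W.prob_increments_le(2)[of "real n" c 1] in auto)
    also have "\<dots> \<le> 2 * c / sqrt (2 * pi * real n)"
      using W.prob_increments_le(1)[of "real n" c 1] n c by simp
    also have "\<dots> = inverse r * (2 / sqrt (2 * pi))"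
      using n r by (simp add: c_def real_sqrt_mult)
    also have "\<dots> \<le> 1 * (4 / 5)"
    proof (rule mult_mono)
      have "5 / 2 \<le> sqrt (2 * pi)"
        using pi_approx by (intro real_le_rsqrt) (simp add: power2_eq_square)
      then show "2 / sqrt (2 * pi) \<le> 4 / 5"
        by (simp add: field_simps)
    qed (use r in \<open>auto simp: inverse_le_1_iff\<close>)
    also have "\<dots> \<le> 1 + - (1/160) * r\<^sup>2"
      using True by simp
    also have "\<dots> \<le> exp (- (1/160) * r\<^sup>2)"
      by (rule exp_ge_add_one_self)
    finally show ?thesis .
  next
    case False
    \<comment> \<open>Rounding down gives \<open>\<delta> \<ge> 16 * c^2\<close>, which makes each
      factor at most 1/2. As \<open>r^2 / 16 > 2\<close>, rounding loses at most half, so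
      \<open>k\<close> keeps the order of \<open>r^2\<close>.\<close>
    define k where "k = nat \<lfloor>r\<^sup>2 / 16\<rfloor>"
    have k: "real k \<le> r\<^sup>2 / 16" "r\<^sup>2 / 32 \<le> real k" "k > 0"
      using False by (auto simp: k_def) linarith+
    define \<delta> where "\<delta> = real n / real k"
    have \<delta>: "\<delta> > 0" using n k by (simp add: \<delta>_def)
    let ?E = "{\<omega> \<in> space M. \<forall>i<k. \<bar>B (real (Suc i) * \<delta>) \<omega> $ 1 - B (real i * \<delta>) \<omega> $ 1\<bar> \<le> 2 * c}"
    have time: "real i * \<delta> \<le> real n" if "i \<le> k" for i
      using that k n by (simp add: \<delta>_def field_simps)
    have "measure (completion M) ?S \<le> prob ?E"
    proof (rule prob_sup_norm_le[where i = 1])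
      show "?E \<in> events"
        by (rule W.prob_increments_le(2)) (use \<delta> c in auto)
      fix \<omega> assume \<omega>: "\<omega> \<in> space M" and *: "\<And>t. 0 \<le> t \<Longrightarrow> t \<le> real n \<Longrightarrow> \<bar>B t \<omega> $ 1\<bar> \<le> c"
      have "\<bar>B (real (Suc i) * \<delta>) \<omega> $ 1 - B (real i * \<delta>) \<omega> $ 1\<bar> \<le> 2 * c" if "i < k" for i
      proof -
        have "\<bar>B (real j * \<delta>) \<omega> $ 1\<bar> \<le> c" if "j \<le> k" for j
          using * time[OF that] \<delta> by (meson less_imp_le mult_nonneg_nonneg of_nat_0_le_iff)
        from this[of "Suc i"] this[of i] that show ?thesis
          by linarith
      qed
      with \<omega> show "\<omega> \<in> ?E" by blast
    qed simp
    also have "\<dots> \<le> (2 * (2 * c) / sqrt (2 * pi * \<delta>)) ^ k"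
      by (rule W.prob_increments_le(1)) (use \<delta> c in auto)
    also have "\<dots> \<le> (1 / 2) ^ k"
    proof (rule power_mono)
      \<comment> \<open>The aim is that the denominator is at least \<open>8 * c\<close>, twice the
        numerator; \<open>64 * c^2 \<le> 4 * \<delta>\<close> suffices because
        \<open>4 \<le> 2 * pi\<close>.\<close>
      have "c\<^sup>2 = real n / r\<^sup>2"
        using r by (simp add: c_def power_mult_distrib field_simps)
      also have "\<dots> \<le> \<delta> / 16"
        using k r n by (simp add: \<delta>_def field_simps)
      finally have "64 * c\<^sup>2 \<le> 4 * \<delta>" by simp
      also have "\<dots> \<le> 2 * pi * \<delta>"
        using \<delta> pi_gt3 by simp
      finally have "8 * c \<le> sqrt (2 * pi * \<delta>)"
        by (intro real_le_rsqrt) (simp add: power_mult_distrib)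
      then show "2 * (2 * c) / sqrt (2 * pi * \<delta>) \<le> 1 / 2"
        using \<delta> by (simp add: field_simps)
    qed (use c \<delta> in auto)
    also have "\<dots> \<le> exp (- (1 / 2)) ^ k"
      using exp_ge_add_one_self[of "- (1 / 2)"] by (intro power_mono) auto
    also have "\<dots> = exp (- (real k / 2))"
      by (simp flip: exp_of_nat_mult)
    \<comment> \<open>Here \<open>k / 2 \<ge> r^2 / 64 \<ge> r^2 / 160\<close>.\<close>
    also have "\<dots> \<le> exp (- (1/160) * r\<^sup>2)"
      using k r by (auto simp: field_simps)
    finally show ?thesis .
  qed
  then show "measure (completion M) {\<omega> \<in> space M. (SUP t\<in>{0..real n}. norm (B t \<omega>)) \<le> inverse r * sqrt (real n)}
      \<le> exp (- (1/160) * r\<^sup>2)"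
    by (simp only: c_def)
qed simp

end
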